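(* For every $n\ge0$, every element of $\mathcal B_{[n]}$ is a $P$-cycle in $W_{[n]}$, and the classes of the elements of $\mathcal B_{[n]}$ form an $\mathbb F_2$-basis of the Margolis homology $\mathcal M(W_{[n]},P)=\ker P/\operatorname{im}P$ (equivalently of $\mathcal M(M_{[n]},P)$).
   Context: Over $\mathbb F_2$, $R=\Lambda(t_i:i\ge1)\otimes\Lambda(x_i:i\ge1)$ with basis the monomials $t_Ix_J$ ($I,J\subset\mathbb N_+$ finite, $t_I=\prod_{i\in I}t_i$, $x_J=\prod_{j\in J}x_j$, $t_It_K=0$ if $I\cap K\neq\emptyset$), with linear operators $Q_1(t_Ix_J)=\sum_{j\in J}t_jt_Ix_{J\setminus\{j\}}$ and $P(t_Ix_J)=\sum_{K\subseteq J,|K|=2}t_Kt_Ix_{J\setminus K}$. For finite $J$, $W_J=\operatorname{span}\{t_Ix_{J\setminus I}:I\subseteq J\}$, closed under $Q_1,P$ and isomorphic as a $\Lambda(Q_1,P)$-module to $M_J=\bigotimes_{j\in J}M_j$, where $M_j$ has basis $t_j,x_j$ with $Q_1x_j=t_j$, $P=0$, and the tensor action uses $\Delta(P)=P\otimes1+Q_1\otimes Q_1+1\otimes P$. $[n]=\{1,\dots,n\}$. The exchange operation is the linear map $(t_Ix_J)^e=t_Jx_I$. Sets $\mathcal B_{[n]}$: $\mathcal B_{[0]}=\{1\}$; given $\mathcal B_{[2t]}$, $\mathcal B_{[2t+1]}=\{Q_1(b\,x_{2t+1})\}\cup\{Q_1(b\,x_{2t+1})^e\}$ and $\mathcal B_{[2t+2]}=\{Q_1(b\,x_{2t+1})x_{2t+2}\}\cup\{Q_1(b\,x_{2t+1})^e\,t_{2t+2}\}$,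 with $b$ ranging over $\mathcal B_{[2t]}$. *)

theory Defs
  imports Main "HOL-Library.Z2"
begin

text \<open>Elements of R over F_2: coefficient functions on the monomial basis t_I x_J,
  indexed by pairs (I, J) of finite subsets of the positive integers.\<close>

type_synonym mon = "nat set \<times> nat set"
type_synonym elem = "mon \<Rightarrow> bit"

definition supp :: "elem \<Rightarrow> mon set" where
  "supp v = {m. v m \<noteq> 0}"

definition mono :: "nat set \<Rightarrow> nat set \<Rightarrow> elem" where
  "mono I J = (\<lambda>m. if m = (I, J) then 1 else 0)"

definition zeroE :: elem where "zeroE = (\<lambda>m. 0)"

definition addE :: "elem \<Rightarrow> elem \<Rightarrow> elem" where
  "addE u v = (\<lambda>m. u m + v m)"

definition sumE :: "elem set \<Rightarrow> elem" where
  "sumE S = (\<lambda>m. \<Sum>v\<in>S. v m)"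

definition lin :: "(mon \<Rightarrow> elem) \<Rightarrow> elem \<Rightarrow> elem" where
  "lin f v = (\<lambda>k. \<Sum>m\<in>supp v. v m * f m k)"

definition tmon :: "nat set \<Rightarrow> nat set \<Rightarrow> nat set \<Rightarrow> elem" where
  "tmon K I J = (if K \<inter> I = {} then mono (K \<union> I) J else zeroE)"

definition Q1mon :: "mon \<Rightarrow> elem" where
  "Q1mon m = (case m of (I, J) \<Rightarrow> (\<lambda>k. \<Sum>j\<in>J. tmon {j} I (J - {j}) k))"

definition Pmon :: "mon \<Rightarrow> elem" where
  "Pmon m = (case m of (I, J) \<Rightarrow>
      (\<lambda>k. \<Sum>K\<in>{K. K \<subseteq> J \<and> card K = 2}. tmon K I (J - K) k))"

definition Q1 :: "elem \<Rightarrow> elem" where "Q1 = lin Q1mon"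
definition P :: "elem \<Rightarrow> elem" where "P = lin Pmon"

text \<open>Right multiplication by x_a and by t_a (exterior algebra, characteristic 2).\<close>
definition mulx :: "elem \<Rightarrow> nat \<Rightarrow> elem" where
  "mulx v a = lin (\<lambda>(I, J). if a \<in> J then zeroE else mono I (insert a J)) v"

definition mult :: "elem \<Rightarrow> nat \<Rightarrow> elem" where
  "mult v a = lin (\<lambda>(I, J). if a \<in> I then zeroE else mono (insert a I) J) v"

definition exch :: "elem \<Rightarrow> elem" where
  "exch = lin (\<lambda>(I, J). mono J I)"

text \<open>W_J = span of t_I x_{J - I}, I \<subseteq> J (J finite).\<close>
definition W :: "nat set \<Rightarrow> elem set" where
  "W J = {v. \<forall>m \<in> supp v. \<exists>I. I \<subseteq> J \<and> m = (I, J - I)}"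

fun Beven :: "nat \<Rightarrow> elem set" where
  "Beven 0 = {mono {} {}}"
| "Beven (Suc t) =
     (\<lambda>b. mulx (Q1 (mulx b (2*t+1))) (2*t+2)) ` Beven t
     \<union> (\<lambda>b. mult (exch (Q1 (mulx b (2*t+1)))) (2*t+2)) ` Beven t"

definition B :: "nat \<Rightarrow> elem set" where
  "B n = (if even n then Beven (n div 2)
          else (\<lambda>b. Q1 (mulx b (n))) ` Beven (n div 2)
               \<union> (\<lambda>b. exch (Q1 (mulx b n))) ` Beven (n div 2))"

end

theory Submission
  imports Defs "HOL-Library.Function_Algebras"
begin

text \<open>Let \<open>F\<close> be the conjugate of \<open>Q\<^sub>1\<close> under the exchange operation. On \<open>V = W\<^sub>N\<close> with \<open>N\<close> of even
  size one has \<open>F Q\<^sub>1 = Q\<^sub>1 F\<close> and \<open>P F + F P = Q\<^sub>1\<close>. Hence \<open>T = 1 + Q\<^sub>1 F\<close> is an involution of the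
  complex \<open>(V, P)\<close>, and \<open>f v = (Q\<^sub>1 v) x\<^sub>a + v t\<^sub>a\<close>, \<open>g v = v x\<^sub>a + (F v) t\<^sub>a\<close> are chain maps from
  \<open>V\<close> to \<open>V \<otimes> M\<^sub>a\<close>. Together they induce an isomorphism from two copies of the homology of \<open>V\<close> to
  that of \<open>V \<otimes> M\<^sub>a\<close>, and \<open>f x\<^sub>b\<close>, \<open>g t\<^sub>b\<close> do the same for \<open>V \<otimes> M\<^sub>a \<otimes> M\<^sub>b\<close>; up to boundaries, \<open>T\<close>
  accounts for the difference between these maps and the inclusions of the summands. Since \<open>f v\<close> is
  \<open>Q\<^sub>1 (v x\<^sub>a)\<close> and \<open>g (v\<^sup>e)\<close> is its exchange, and the sets \<open>B\<^bsub>[2t]\<^esub>\<close> are closed under exchange, bases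
  propagate along the recursion defining them.\<close>

section \<open>Arithmetic of coefficient functions in characteristic 2\<close>

declare add_bit_eq_xor [simp del] mult_bit_eq_and [simp del]
declare plus_fun_apply [simp del] zero_fun_apply [simp del]

lemmas pointwise = plus_fun_apply zero_fun_apply

lemma zeroE_eq: "zeroE = 0"
  by (simp add: zeroE_def fun_eq_iff pointwise)

lemma addE_eq: "addE u v = u + v"
  by (simp add: addE_def fun_eq_iff pointwise)

lemma sum_elem_apply: "(\<Sum>i\<in>A. f i) m = (\<Sum>i\<in>A. (f i :: elem) m)"
  by (induction A rule: infinite_finite_induct) (auto simp: pointwise)

lemma sumE_eq: "sumE S = \<Sum>S"
  by (simp add: sumE_def fun_eq_iff pointwise sum_elem_apply)

lemma elem_add_self: "(u::elem) + u = 0"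
proof
  show "(u + u) m = 0 m" for m
    by (cases "u m") (simp_all add: pointwise)
qed

lemma elem_add_self_left: "(u::elem) + (u + v) = v"
  by (simp add: elem_add_self flip: add.assoc)

text \<open>Commutativity brings equal summands together, where they cancel; this normalises sums in
  a group of exponent 2.\<close>

lemmas char2 = elem_add_self elem_add_self_left add.assoc add.commute add.left_commute

lemma elem_add_eq_0_iff: "(u::elem) + v = 0 \<longleftrightarrow> u = v"
  by (metis add.right_neutral elem_add_self elem_add_self_left)

lemma elem_add_eq_iff: "(u::elem) + v = w \<longleftrightarrow> u = w + v"
  by (metis add.commute elem_add_self_left)

subsection \<open>Linear extension\<close>

lemma finite_supp_0 [simp]: "finite (supp 0)"
  by (simp add: supp_def pointwise)

lemma finite_supp_add [simp]: "finite (supp u) \<Longrightarrow> finite (supp v) \<Longrightarrow> finite (supp (u + v))"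
  by (rule finite_subset[of _ "supp u \<union> supp v"]) (auto simp: supp_def pointwise)

lemma finite_supp_sum: "(\<And>i. i \<in> A \<Longrightarrow> finite (supp (f i))) \<Longrightarrow> finite (supp (\<Sum>i\<in>A. f i))"
  by (induction A rule: infinite_finite_induct) auto

lemma finite_supp_mono [simp]: "finite (supp (mono I J))"
  by (rule finite_subset[of _ "{(I, J)}"]) (auto simp: supp_def mono_def)

lemma finite_supp_tmon [simp]: "finite (supp (tmon K I J))"
  by (simp add: tmon_def zeroE_eq)

lemma lin_eq_sum:
  assumes "finite A" "supp v \<subseteq> A"
  shows "lin f v k = (\<Sum>m\<in>A. v m * f m k)"
  unfolding lin_def by (rule sum.mono_neutral_left) (use assms in \<open>auto simp: supp_def\<close>)

text \<open>The union of both supports serves as index set for all three sums. Finiteness matters: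
  over an infinite support the defining sum takes the default value 0.\<close>

lemma lin_add:
  assumes "finite (supp u)" "finite (supp v)"
  shows "lin f (u + v) = lin f u + lin f v"
proof
  fix k
  have "supp (u + v) \<subseteq> supp u \<union> supp v"
    by (auto simp: supp_def pointwise)
  then show "lin f (u + v) k = (lin f u + lin f v) k"
    using assms
    by (simp add: lin_eq_sum[of "supp u \<union> supp v"] distrib_right sum.distrib pointwise)
qed

lemma lin_0 [simp]: "lin f 0 = 0"
  by (simp add: lin_def supp_def fun_eq_iff pointwise)

lemma lin_mono: "lin f (mono I J) = f (I, J)"
proof
  fix k
  show "lin f (mono I J) k = f (I, J) k"
    by (subst lin_eq_sum[of "{(I, J)}"]) (auto simp: supp_def mono_def)
qed

lemma lin_sum:
  assumes "\<And>i. i \<in> A \<Longrightarrow> finite (supp (h i))"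
  shows "lin f (\<Sum>i\<in>A. h i) = (\<Sum>i\<in>A. lin f (h i))"
  using assms
  by (induction A rule: infinite_finite_induct) (auto simp: lin_add finite_supp_sum)

lemma finite_supp_lin:
  assumes "\<And>m. finite (supp (f m))"
  shows "finite (supp (lin f v))"
proof (cases "finite (supp v)")
  case True
  show ?thesis
  proof (rule finite_subset)
    show "supp (lin f v) \<subseteq> (\<Union>m\<in>supp v. supp (f m))"
    proof
      fix k
      assume "k \<in> supp (lin f v)"
      then have "(\<Sum>m\<in>supp v. v m * f m k) \<noteq> 0"
        by (simp add: supp_def lin_def)
      then obtain m where "m \<in> supp v" "v m * f m k \<noteq> 0"
        by (rule sum.not_neutral_contains_not_neutral)
      then show "k \<in> (\<Union>m\<in>supp v. supp (f m))"
        by (intro UN_I[of m]) (auto simp: supp_def)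
    qed
  qed (use True assms in auto)
next
  case False
  then show ?thesis
    by (simp add: lin_def supp_def)
qed

section \<open>The operators on monomials and their coefficient formulas\<close>

lemma Q1mon_eq: "Q1mon (I, J) = (\<Sum>j\<in>J. tmon {j} I (J - {j}))"
  by (rule ext) (simp add: Q1mon_def sum_elem_apply)

lemma Pmon_eq: "Pmon (I, J) = (\<Sum>K | K \<subseteq> J \<and> card K = 2. tmon K I (J - K))"
  by (rule ext) (simp add: Pmon_def sum_elem_apply)

lemma finite_supp_ops [simp]:
  "finite (supp (Q1 v))" "finite (supp (P v))" "finite (supp (mulx v a))"
  "finite (supp (mult v a))" "finite (supp (exch v))"
  unfolding Q1_def P_def mulx_def mult_def exch_def
  by (rule finite_supp_lin; clarsimp simp: Q1mon_eq Pmon_eq zeroE_eq finite_supp_sum)+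

lemma ops_0 [simp]:
  "Q1 0 = 0" "P 0 = 0" "mulx 0 a = 0" "mult 0 a = 0" "exch 0 = 0"
  by (simp_all add: Q1_def P_def mulx_def mult_def exch_def)

lemma ops_add:
  assumes "finite (supp u)" "finite (supp v)"
  shows "Q1 (u + v) = Q1 u + Q1 v" "P (u + v) = P u + P v"
    "mulx (u + v) a = mulx u a + mulx v a" "mult (u + v) a = mult u a + mult v a"
    "exch (u + v) = exch u + exch v"
  using assms by (simp_all add: Q1_def P_def mulx_def mult_def exch_def lin_add)

lemma ops_mono:
  "Q1 (mono I J) = (\<Sum>j\<in>J. tmon {j} I (J - {j}))"
  "P (mono I J) = (\<Sum>K | K \<subseteq> J \<and> card K = 2. tmon K I (J - K))"
  "mulx (mono I J) a = (if a \<in> J then 0 else mono I (insert a J))"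
  "mult (mono I J) a = (if a \<in> I then 0 else mono (insert a I) J)"
  "exch (mono I J) = mono J I"
  by (simp_all add: Q1_def P_def mulx_def mult_def exch_def lin_mono Q1mon_eq Pmon_eq zeroE_eq)

lemma mul_sum:
  assumes "\<And>i. i \<in> A \<Longrightarrow> finite (supp (h i))"
  shows "mulx (\<Sum>i\<in>A. h i) a = (\<Sum>i\<in>A. mulx (h i) a)"
    "mult (\<Sum>i\<in>A. h i) a = (\<Sum>i\<in>A. mult (h i) a)"
  using assms by (simp_all add: mulx_def mult_def lin_sum)

text \<open>Under multiplication by x_a a monomial t_I x_J with a in J arises from one monomial
  only, t_I x_{J - {a}}.\<close>

lemma mulx_apply:
  assumes "finite (supp v)"
  shows "mulx v a (I, J) = (if a \<in> J then v (I, J - {a}) else 0)"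
proof -
  \<comment> \<open>The candidate preimage may lie outside the support of \<open>v\<close>, so it is
    inserted; at most one term of the sum is then nonzero.\<close>
  let ?A = "insert (I, J - {a}) (supp v)"
  have "mulx v a (I, J) =
    (\<Sum>m\<in>?A. v m * (case m of (I, J) \<Rightarrow> if a \<in> J then zeroE else mono I (insert a J)) (I, J))"
    unfolding mulx_def by (rule lin_eq_sum) (use assms in auto)
  also have "\<dots> = (\<Sum>m\<in>?A. if m = (I, J - {a}) then (if a \<in> J then v m else 0) else 0)"
  proof (rule sum.cong)
    fix m :: mon
    obtain I' J' where m: "m = (I', J')"
      by (cases m)
    have "(a \<notin> J' \<and> (I, J) = (I', insert a J')) \<longleftrightarrow> (a \<in> J \<and> m = (I, J - {a}))"
      unfolding m by blast
    moreover have "v m * (case m of (I, J) \<Rightarrow> if a \<in> J then zeroE else mono I (insert a J)) (I, J) =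
      (if (a \<notin> J' \<and> (I, J) = (I', insert a J')) then v m else 0)"
      by (simp add: m zeroE_def mono_def)
    ultimately show "v m * (case m of (I, J) \<Rightarrow> if a \<in> J then zeroE else mono I (insert a J)) (I, J) =
      (if m = (I, J - {a}) then (if a \<in> J then v m else 0) else 0)"
      by simp
  qed simp
  finally show ?thesis
    using assms by simp
qed

lemma mult_apply:
  assumes "finite (supp v)"
  shows "mult v a (I, J) = (if a \<in> I then v (I - {a}, J) else 0)"
proof -
  let ?A = "insert (I - {a}, J) (supp v)"
  have "mult v a (I, J) =
    (\<Sum>m\<in>?A. v m * (case m of (I, J) \<Rightarrow> if a \<in> I then zeroE else mono (insert a I) J) (I, J))"
    unfolding mult_def by (rule lin_eq_sum) (use assms in auto)
  also have "\<dots> = (\<Sum>m\<in>?A. if m = (I - {a}, J) then (if a \<in> I then v m else 0) else 0)"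
  proof (rule sum.cong)
    fix m :: mon
    obtain I' J' where m: "m = (I', J')"
      by (cases m)
    have "(a \<notin> I' \<and> (I, J) = (insert a I', J')) \<longleftrightarrow> (a \<in> I \<and> m = (I - {a}, J))"
      unfolding m by blast
    moreover have "v m * (case m of (I, J) \<Rightarrow> if a \<in> I then zeroE else mono (insert a I) J) (I, J) =
      (if (a \<notin> I' \<and> (I, J) = (insert a I', J')) then v m else 0)"
      by (simp add: m zeroE_def mono_def)
    ultimately show "v m * (case m of (I, J) \<Rightarrow> if a \<in> I then zeroE else mono (insert a I) J) (I, J) =
      (if m = (I - {a}, J) then (if a \<in> I then v m else 0) else 0)"
      by simp
  qed simp
  finally show ?thesis
    using assms by simp
qed

lemma exch_apply:
  assumes "finite (supp v)"
  shows "exch v (I, J) = v (J, I)"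
proof -
  let ?A = "insert (J, I) (supp v)"
  have "exch v (I, J) = (\<Sum>m\<in>?A. v m * (case m of (I, J) \<Rightarrow> mono J I) (I, J))"
    unfolding exch_def by (rule lin_eq_sum) (use assms in auto)
  also have "\<dots> = (\<Sum>m\<in>?A. if m = (J, I) then v m else 0)"
    by (rule sum.cong) (auto simp: mono_def split: if_splits)
  finally show ?thesis
    using assms by simp
qed

lemma exch_exch: "finite (supp v) \<Longrightarrow> exch (exch v) = v"
  by (rule ext) (simp add: exch_apply split_paired_all)

subsection \<open>Splitting off one index\<close>

lemma W_iff: "v \<in> W N \<longleftrightarrow> (\<forall>m. v m \<noteq> 0 \<longrightarrow> (\<exists>I\<subseteq>N. m = (I, N - I)))"
  unfolding W_def supp_def by blast

lemma W_eq_0: "v \<in> W N \<Longrightarrow> \<not> (\<exists>I\<subseteq>N. m = (I, N - I)) \<Longrightarrow> v m = 0"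
  unfolding W_iff by blast

lemma W_0 [simp]: "0 \<in> W N"
  by (simp add: W_iff pointwise)

lemma W_add [simp]:
  assumes "u \<in> W N" "v \<in> W N"
  shows "u + v \<in> W N"
  unfolding W_iff
proof (intro allI impI)
  fix m
  assume "(u + v) m \<noteq> 0"
  then have "u m \<noteq> 0 \<or> v m \<noteq> 0"
    by (cases "u m"; cases "v m") (simp_all add: pointwise)
  then show "\<exists>I\<subseteq>N. m = (I, N - I)"
    using assms unfolding W_iff by blast
qed

lemma mono_in_W: "I \<subseteq> N \<Longrightarrow> mono I (N - I) \<in> W N"
  by (simp add: W_iff mono_def)

lemma W_finite_supp:
  assumes "finite N" "v \<in> W N"
  shows "finite (supp v)"
proof (rule finite_subset)
  show "supp v \<subseteq> (\<lambda>I. (I, N - I)) ` Pow N"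
    using assms(2) unfolding W_def by blast
qed (use assms(1) in simp)

lemma elem_eq_sum_mono:
  assumes "finite (supp v)"
  shows "v = (\<Sum>m\<in>supp v. mono (fst m) (snd m))"
proof
  fix k
  have "(\<Sum>m\<in>supp v. mono (fst m) (snd m) k) = (\<Sum>m\<in>supp v. if m = k then 1 else 0)"
    by (rule sum.cong) (simp_all add: mono_def eq_commute)
  also have "\<dots> = (if k \<in> supp v then 1 else 0)"
    using assms by simp
  also have "\<dots> = v k"
    by (simp add: supp_def)
  finally show "v k = (\<Sum>m\<in>supp v. mono (fst m) (snd m)) k"
    by (simp add: sum_elem_apply)
qed

text \<open>Over F_2 a vector is the sum of the monomials in its support, and these can be added one
  by one. Linear identities on \<open>W N\<close> thereby reduce to monomials.\<close>

lemma W_induct [consumes 2, case_names zero add]: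
  assumes "finite N" "v \<in> W N"
    and "Pr 0"
    and step: "\<And>I u. I \<subseteq> N \<Longrightarrow> u \<in> W N \<Longrightarrow> Pr u \<Longrightarrow> Pr (mono I (N - I) + u)"
  shows "Pr v"
proof -
  have "(\<Sum>m\<in>A. mono (fst m) (snd m)) \<in> W N \<and> Pr (\<Sum>m\<in>A. mono (fst m) (snd m))"
    if "finite A" "A \<subseteq> supp v" for A
    using that
  proof (induction A)
    case (insert m A)
    then obtain I where "I \<subseteq> N" "m = (I, N - I)"
      using \<open>v \<in> W N\<close> by (auto simp: W_def)
    with insert show ?case
      by (simp add: step mono_in_W)
  qed (use \<open>Pr 0\<close> in simp)
  from this[of "supp v"] show ?thesis
    using W_finite_supp[OF assms(1,2)] elem_eq_sum_mono[of v] by simp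
qed

text \<open>This is the action of Q_1 on the tensor product with M_a. The index a itself produces
  the \<open>mult\<close> term; all other indices commute with the multiplication.\<close>

lemma Q1_mul:
  assumes "finite N" "v \<in> W N" "a \<notin> N"
  shows "Q1 (mulx v a) = mulx (Q1 v) a + mult v a" "Q1 (mult v a) = mult (Q1 v) a"
proof -
  have "Q1 (mulx v a) = mulx (Q1 v) a + mult v a \<and> Q1 (mult v a) = mult (Q1 v) a"
    using assms(1,2)
  proof (induction rule: W_induct)
    case (add I u)
    let ?J = "N - I"
    have fin: "finite ?J" "finite (supp u)" and a: "a \<notin> I" "a \<notin> ?J"
      using assms add W_finite_supp by auto
    have "(\<Sum>j\<in>?J. tmon {j} I (insert a ?J - {j})) = mulx (Q1 (mono I ?J)) a"
      unfolding ops_mono mul_sum[OF finite_supp_tmon]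
      by (rule sum.cong) (use a in \<open>auto simp: tmon_def zeroE_eq ops_mono insert_Diff_if\<close>)
    then have x: "Q1 (mulx (mono I ?J) a) = mulx (Q1 (mono I ?J)) a + mult (mono I ?J) a"
      using a fin by (simp add: ops_mono tmon_def char2)
    have t: "Q1 (mult (mono I ?J) a) = mult (Q1 (mono I ?J)) a"
      unfolding ops_mono(1) mul_sum[OF finite_supp_tmon]
      using a
      by (auto simp: ops_mono tmon_def zeroE_eq insert_commute intro!: sum.cong)
    show ?case
      using add fin x t by (simp add: ops_add char2)
  qed simp
  then show "Q1 (mulx v a) = mulx (Q1 v) a + mult v a" "Q1 (mult v a) = mult (Q1 v) a"
    by auto
qed

lemma pairs_insert:
  assumes "finite J" "a \<notin> J"
  shows "{K. K \<subseteq> insert a J \<and> card K = 2} = {K. K \<subseteq> J \<and> card K = 2} \<union> (\<lambda>j. {a, j}) ` J"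
  using assms by (auto simp: card_2_iff)

text \<open>The coproduct of P, with P = 0 on M_a: pairs avoiding a give the \<open>P v\<close>
  terms, and pairs {a, j} give Q_1 \<otimes> Q_1, that is, \<open>Q1 v\<close> with x_a turned into
  t_a.\<close>

lemma P_mul:
  assumes "finite N" "v \<in> W N" "a \<notin> N"
  shows "P (mulx v a) = mulx (P v) a + mult (Q1 v) a" "P (mult v a) = mult (P v) a"
proof -
  have "P (mulx v a) = mulx (P v) a + mult (Q1 v) a \<and> P (mult v a) = mult (P v) a"
    using assms(1,2)
  proof (induction rule: W_induct)
    case (add I u)
    let ?J = "N - I"
    have fin: "finite ?J" "finite (supp u)" and a: "a \<notin> I" "a \<notin> ?J"
      using assms add W_finite_supp by auto
    let ?K = "{K. K \<subseteq> ?J \<and> card K = 2}"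
    have 1: "(\<Sum>K\<in>?K. tmon K I (insert a ?J - K)) = mulx (P (mono I ?J)) a"
      unfolding ops_mono mul_sum[OF finite_supp_tmon]
      by (rule sum.cong) (use a in \<open>auto simp: tmon_def zeroE_eq ops_mono insert_Diff_if\<close>)
    have inj: "inj_on (\<lambda>j. {a, j}) ?J"
      by (auto simp: inj_on_def doubleton_eq_iff)
    have 2: "(\<Sum>K\<in>(\<lambda>j. {a, j}) ` ?J. tmon K I (insert a ?J - K)) = mult (Q1 (mono I ?J)) a"
      unfolding ops_mono mul_sum[OF finite_supp_tmon] sum.reindex[OF inj] o_def
    proof (rule sum.cong)
      fix j
      assume "j \<in> ?J"
      moreover have "insert a ?J - {a, j} = ?J - {j}"
        using a by auto
      ultimately show "tmon {a, j} I (insert a ?J - {a, j}) = mult (tmon {j} I (?J - {j})) a"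
        using a by (auto simp: tmon_def zeroE_eq ops_mono)
    qed simp
    have "finite ?K" "?K \<inter> (\<lambda>j. {a, j}) ` ?J = {}"
      using fin a by auto
    then have x: "P (mulx (mono I ?J) a) = mulx (P (mono I ?J)) a + mult (Q1 (mono I ?J)) a"
      using a fin 1 2 pairs_insert[OF fin(1) a(2)]
      by (simp add: ops_mono(2)[of _ "insert a ?J"] ops_mono(3) sum.union_disjoint)
    have t: "P (mult (mono I ?J) a) = mult (P (mono I ?J)) a"
      unfolding ops_mono(2) mul_sum[OF finite_supp_tmon]
      using a
      by (auto simp: ops_mono tmon_def zeroE_eq intro!: sum.cong)
    show ?case
      using add fin x t by (simp add: ops_add char2)
  qed simp
  then show "P (mulx v a) = mulx (P v) a + mult (Q1 v) a" "P (mult v a) = mult (P v) a"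
    by auto
qed

lemma exch_mul:
  assumes "finite (supp v)"
  shows "exch (mulx v a) = mult (exch v) a" "exch (mult v a) = mulx (exch v) a"
  by (rule ext, simp add: assms exch_apply mulx_apply mult_apply split_paired_all)+

lemma mul_in_W:
  assumes "finite N" "a \<notin> N" "v \<in> W N"
  shows "mulx v a \<in> W (insert a N)" "mult v a \<in> W (insert a N)"
proof -
  have fin: "finite (supp v)"
    using assms W_finite_supp by auto
  show "mulx v a \<in> W (insert a N)"
    unfolding W_def
  proof (intro CollectI ballI)
    fix m
    assume m: "m \<in> supp (mulx v a)"
    obtain I J where IJ: "m = (I, J)"
      by fastforce
    with m have "mulx v a (I, J) \<noteq> 0"
      by (simp add: supp_def)
    then have "a \<in> J" "v (I, J - {a}) \<noteq> 0"
      by (simp_all add: mulx_apply[OF fin] split: if_splits)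
    have "\<exists>I'\<subseteq>N. (I, J - {a}) = (I', N - I')"
      using \<open>v (I, J - {a}) \<noteq> 0\<close> by (rule assms(3)[unfolded W_iff, rule_format])
    then have "I \<subseteq> N" "J - {a} = N - I"
      by simp_all
    with \<open>a \<in> J\<close> \<open>a \<notin> N\<close> have "I \<subseteq> insert a N" "J = insert a N - I"
      by auto
    then show "\<exists>I\<subseteq>insert a N. m = (I, insert a N - I)"
      using IJ by blast
  qed
  show "mult v a \<in> W (insert a N)"
    unfolding W_def
  proof (intro CollectI ballI)
    fix m
    assume m: "m \<in> supp (mult v a)"
    obtain I J where IJ: "m = (I, J)"
      by fastforce
    with m have "mult v a (I, J) \<noteq> 0"
      by (simp add: supp_def)
    then have "a \<in> I" "v (I - {a}, J) \<noteq> 0"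
      by (simp_all add: mult_apply[OF fin] split: if_splits)
    have "\<exists>I'\<subseteq>N. (I - {a}, J) = (I', N - I')"
      using \<open>v (I - {a}, J) \<noteq> 0\<close> by (rule assms(3)[unfolded W_iff, rule_format])
    then have "I - {a} \<subseteq> N" "J = N - (I - {a})"
      by simp_all
    with \<open>a \<in> I\<close> \<open>a \<notin> N\<close> have "I \<subseteq> insert a N" "J = insert a N - I"
      by auto
    then show "\<exists>I\<subseteq>insert a N. m = (I, insert a N - I)"
      using IJ by blast
  qed
qed

text \<open>Existence half of the direct sum decomposition of \<open>W (insert a N)\<close>: a
  monomial belongs to the t_a part or the x_a part according to whether a lies in its t-index
  set.\<close>

lemma W_insertE:
  assumes "finite N" "a \<notin> N" "w \<in> W (insert a N)"
  obtains u v where "u \<in> W N" "v \<in> W N" "w = mulx u a + mult v a"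
proof -
  have "finite (insert a N)"
    using assms by simp
  from this assms(3) have "\<exists>u\<in>W N. \<exists>v\<in>W N. w = mulx u a + mult v a"
  proof (induction rule: W_induct)
    case zero
    show ?case
      by (rule bexI[of _ 0], rule bexI[of _ 0]) simp_all
  next
    case (add I w)
    then obtain u v where uv: "u \<in> W N" "v \<in> W N" "w = mulx u a + mult v a"
      by blast
    then have fin: "finite (supp u)" "finite (supp v)"
      using assms W_finite_supp by auto
    show ?case
    proof (cases "a \<in> I")
      case True
      have "mono (I - {a}) (N - (I - {a})) \<in> W N"
        using add by (intro mono_in_W) auto
      moreover have "N - (I - {a}) = N - I"
        using assms by auto
      ultimately have "mono (I - {a}) (N - I) \<in> W N"
        "mono I (insert a N - I) = mult (mono (I - {a}) (N - I)) a"
        using True by (auto simp: ops_mono insert_absorb)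
      with uv fin show ?thesis
        by (intro bexI[of _ u] bexI[of _ "mono (I - {a}) (N - I) + v"]) (auto simp: ops_add char2)
    next
      case False
      have "mono I (N - I) \<in> W N"
        using add False by (intro mono_in_W) auto
      moreover have "mono I (insert a N - I) = mulx (mono I (N - I)) a"
        using False assms by (auto simp: ops_mono insert_Diff_if)
      ultimately show ?thesis
        using uv fin
        by (intro bexI[of _ "mono I (N - I) + u"] bexI[of _ v]) (auto simp: ops_add char2)
    qed
  qed
  then show ?thesis
    using that by blast
qed

text \<open>Uniqueness half: monomials involving a do not occur in \<open>W N\<close>, and on the
  others each component is recovered from a coefficient with a put back. Equations in
  \<open>W (insert a N)\<close> thus become pairs of equations in \<open>W N\<close>.\<close>

lemma mul_add_eq_iff:
  assumes "finite N" "a \<notin> N" "u \<in> W N" "v \<in> W N" "u' \<in> W N" "v' \<in> W N"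
  shows "mulx u a + mult v a = mulx u' a + mult v' a \<longleftrightarrow> u = u' \<and> v = v'"
proof
  assume eq: "mulx u a + mult v a = mulx u' a + mult v' a"
  note fin = assms(3-)[THEN W_finite_supp[OF assms(1)]]
  have "u (I, J) = u' (I, J)" "v (I, J) = v' (I, J)" for I J
  proof -
    show "u (I, J) = u' (I, J)"
    proof (cases "a \<in> I \<or> a \<in> J")
      case True
      then have "\<not> (\<exists>I'\<subseteq>N. (I, J) = (I', N - I'))"
        using \<open>a \<notin> N\<close> by blast
      from W_eq_0[OF assms(3) this] W_eq_0[OF assms(5) this] show ?thesis
        by simp
    next
      case False
      then show ?thesis
        using fun_cong[OF eq, of "(I, insert a J)"] fin by (simp add: mulx_apply mult_apply pointwise)
    qed
    show "v (I, J) = v' (I, J)"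
    proof (cases "a \<in> I \<or> a \<in> J")
      case True
      then have "\<not> (\<exists>I'\<subseteq>N. (I, J) = (I', N - I'))"
        using \<open>a \<notin> N\<close> by blast
      from W_eq_0[OF assms(4) this] W_eq_0[OF assms(6) this] show ?thesis
        by simp
    next
      case False
      then show ?thesis
        using fun_cong[OF eq, of "(insert a I, J)"] fin by (simp add: mulx_apply mult_apply pointwise)
    qed
  qed
  then show "u = u' \<and> v = v'"
    by (intro conjI ext; simp only: split_paired_all)
qed simp

subsection \<open>The lowering operator\<close>

text \<open>The operator F of the overview: it replaces each factor t_i in turn by x_i.\<close>

definition lower :: "elem \<Rightarrow> elem" where
  "lower v = exch (Q1 (exch v))"

lemma finite_supp_lower [simp]: "finite (supp (lower v))"
  by (simp add: lower_def)

lemma lower_0 [simp]: "lower 0 = 0"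
  by (simp add: lower_def)

lemma lower_add: "finite (supp u) \<Longrightarrow> finite (supp v) \<Longrightarrow> lower (u + v) = lower u + lower v"
  by (simp add: lower_def ops_add)

lemma ops_W_empty:
  assumes "v \<in> W {}"
  shows "Q1 v = 0" "P v = 0" "exch v = v"
proof -
  have "finite ({} :: nat set)"
    by simp
  from this assms have "Q1 v = 0 \<and> P v = 0 \<and> exch v = v"
  proof (induction rule: W_induct)
    case (add I u)
    then have "I = {}" "finite (supp u)"
      using W_finite_supp[of "{}" u] by auto
    moreover have "(\<Sum>K | K = {} \<and> card K = 2. tmon K K K) = 0"
      by (rule sum.neutral) auto
    ultimately show ?case
      using add by (simp add: ops_add ops_mono)
  qed simp
  then show "Q1 v = 0" "P v = 0" "exch v = v"
    by auto
qed

lemma ops_in_W: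
  assumes "finite N" "v \<in> W N"
  shows "Q1 v \<in> W N" "P v \<in> W N" "exch v \<in> W N" "lower v \<in> W N"
proof -
  have *: "Q1 v \<in> W N \<and> P v \<in> W N \<and> exch v \<in> W N" if "v \<in> W N" for v
    using \<open>finite N\<close> that
  proof (induction N arbitrary: v)
    case empty
    then show ?case
      by (simp add: ops_W_empty)
  next
    case (insert a N)
    then obtain u w where uw: "u \<in> W N" "w \<in> W N" "v = mulx u a + mult w a"
      by (metis W_insertE)
    then have "finite (supp u)" "finite (supp w)"
      using insert W_finite_supp by auto
    with uw insert show ?case
      by (simp add: ops_add Q1_mul[of N] P_mul[of N] exch_mul mul_in_W)
  qed
  show "Q1 v \<in> W N" "P v \<in> W N" "exch v \<in> W N" "lower v \<in> W N"
    using * assms by (simp_all add: lower_def)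
qed

text \<open>The mirror of \<open>Q1_mul\<close> under exchange: on M_a the operator sends t_a to x_a
  and x_a to 0.\<close>

lemma lower_mul:
  assumes "finite N" "v \<in> W N" "a \<notin> N"
  shows "lower (mulx v a) = mulx (lower v) a" "lower (mult v a) = mulx v a + mult (lower v) a"
proof -
  have "finite (supp v)" "exch v \<in> W N"
    using assms W_finite_supp ops_in_W by auto
  then show "lower (mulx v a) = mulx (lower v) a" "lower (mult v a) = mulx v a + mult (lower v) a"
    using assms
    by (simp_all add: lower_def exch_mul Q1_mul[of N] ops_add exch_exch char2)
qed

text \<open>Modulo 2 these are the divided-power relations of \<open>sl\<^sub>2\<close>, with \<open>Q\<^sub>1 = E\<close>,
  \<open>P = E\<^sup>2/2\<close>, \<open>lower = F\<close> and \<open>H\<close> acting as \<open>card N\<close>.\<close>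

lemma commutation_relations:
  assumes "finite N" "v \<in> W N"
  shows "Q1 (Q1 v) = 0" "P (Q1 v) = Q1 (P v)" "P (P v) = 0"
    "Q1 (lower v) = lower (Q1 v) + (if even (card N) then 0 else v)"
    "P (lower v) = lower (P v) + (if even (card N) then Q1 v else 0)"
proof -
  have "Q1 (Q1 v) = 0 \<and> P (Q1 v) = Q1 (P v) \<and> P (P v) = 0
    \<and> Q1 (lower v) = lower (Q1 v) + (if even (card N) then 0 else v)
    \<and> P (lower v) = lower (P v) + (if even (card N) then Q1 v else 0)"
    using assms
  proof (induction N arbitrary: v)
    case empty
    then show ?case
      by (simp add: ops_W_empty lower_def)
  next
    case (insert a N)
    then obtain u w where uw: "u \<in> W N" "w \<in> W N" and v: "v = mulx u a + mult w a"
      by (metis W_insertE)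
    have fin: "finite (supp u)" "finite (supp w)"
      using uw insert W_finite_supp by auto
    note mul = Q1_mul[OF \<open>finite N\<close> _ \<open>a \<notin> N\<close>] P_mul[OF \<open>finite N\<close> _ \<open>a \<notin> N\<close>]
      lower_mul[OF \<open>finite N\<close> _ \<open>a \<notin> N\<close>]
    note IH = insert.IH[OF uw(1)] insert.IH[OF uw(2)]
    \<comment> \<open>Adjoining a flips the parity, so each case of the hypothesis yields the other
      case of the claim. For \<open>Q1\<close> and \<open>lower\<close> the change is their
      commutator on M_a, which is 1.\<close>
    show ?case
      unfolding v
      using uw fin IH insert.hyps
      by (cases "even (card N)") (simp_all add: ops_add lower_add mul ops_in_W char2)
  qed
  then show "Q1 (Q1 v) = 0" "P (Q1 v) = Q1 (P v)" "P (P v) = 0"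
    "Q1 (lower v) = lower (Q1 v) + (if even (card N) then 0 else v)"
    "P (lower v) = lower (P v) + (if even (card N) then Q1 v else 0)"
    by blast+
qed

lemma lower_lower:
  assumes "finite N" "v \<in> W N"
  shows "lower (lower v) = 0"
  using commutation_relations(1)[OF assms(1) ops_in_W(3)[OF assms]]
  by (simp add: lower_def exch_exch)

subsection \<open>Bases of Margolis homology\<close>

text \<open>Over F_2 a linear combination is a subset sum and subtraction is addition. So
  independence says that no nonempty subset sums to a boundary, which also keeps the classes of
  distinct elements distinct.\<close>

definition margolis_basis :: "nat set \<Rightarrow> elem set \<Rightarrow> bool" where
  "margolis_basis N Bs \<longleftrightarrow> finite Bs \<and> (\<forall>b\<in>Bs. b \<in> W N \<and> P b = 0)
    \<and> (\<forall>S. S \<subseteq> Bs \<and> \<Sum>S \<in> P ` W N \<longrightarrow> S = {})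
    \<and> (\<forall>z\<in>W N. P z = 0 \<longrightarrow> (\<exists>S. S \<subseteq> Bs \<and> z + \<Sum>S \<in> P ` W N))"

lemma sum_symdiff:
  assumes "finite A" "finite C"
  shows "\<Sum>A + \<Sum>C = (\<Sum>(A - C \<union> (C - A)) :: elem)"
proof -
  have "\<Sum>A = \<Sum>(A - C) + \<Sum>(A \<inter> C)" "\<Sum>C = \<Sum>(C - A) + \<Sum>(A \<inter> C)"
    using sum.Int_Diff[OF assms(1), of "\<lambda>x. x" C] sum.Int_Diff[OF assms(2), of "\<lambda>x. x" A]
    by (simp_all add: Int_commute add.commute)
  moreover have "\<Sum>(A - C \<union> (C - A)) = \<Sum>(A - C) + \<Sum>(C - A)"
    using assms by (intro sum.union_disjoint) auto
  ultimately show ?thesis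
    by (simp add: char2)
qed

text \<open>The hypotheses make f and g chain maps that jointly induce an isomorphism from two
  copies of the homology of \<open>W N\<close> to that of \<open>W N'\<close>, and such a map
  carries bases to bases. Injectivity on vectors identifies the sum over an image set with the image
  of the sum.\<close>

lemma margolis_basis_transfer:
  assumes fin: "finite N" "finite N'" and basis: "margolis_basis N Bs"
    and f_add: "\<And>u v. u \<in> W N \<Longrightarrow> v \<in> W N \<Longrightarrow> f (u + v) = f u + f v"
    and g_add: "\<And>u v. u \<in> W N \<Longrightarrow> v \<in> W N \<Longrightarrow> g (u + v) = g u + g v"
    and f_W: "\<And>v. v \<in> W N \<Longrightarrow> f v \<in> W N'" and g_W: "\<And>v. v \<in> W N \<Longrightarrow> g v \<in> W N'"
    and f_P: "\<And>v. v \<in> W N \<Longrightarrow> P (f v) = f (P v)" and g_P: "\<And>v. v \<in> W N \<Longrightarrow> P (g v) = g (P v)"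
    and inj: "inj_on f (W N)" "inj_on g (W N)"
    and homology_inj: "\<And>s t. s \<in> W N \<Longrightarrow> t \<in> W N \<Longrightarrow> P s = 0 \<Longrightarrow> P t = 0 \<Longrightarrow>
      f s + g t \<in> P ` W N' \<Longrightarrow> s \<in> P ` W N \<and> t \<in> P ` W N"
    and homology_surj: "\<And>z. z \<in> W N' \<Longrightarrow> P z = 0 \<Longrightarrow>
      \<exists>s\<in>W N. \<exists>t\<in>W N. P s = 0 \<and> P t = 0 \<and> z + (f s + g t) \<in> P ` W N'"
  shows "margolis_basis N' (f ` Bs \<union> g ` Bs)"
proof -
  have fB: "finite Bs" and cycle: "\<And>b. b \<in> Bs \<Longrightarrow> b \<in> W N" "\<And>b. b \<in> Bs \<Longrightarrow> P b = 0"
    and indep: "\<And>S. S \<subseteq> Bs \<Longrightarrow> \<Sum>S \<in> P ` W N \<Longrightarrow> S = {}"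
    and span: "\<And>z. z \<in> W N \<Longrightarrow> P z = 0 \<Longrightarrow> \<exists>S. S \<subseteq> Bs \<and> z + \<Sum>S \<in> P ` W N"
    using basis unfolding margolis_basis_def by blast+
  have f0: "f 0 = 0" and g0: "g 0 = 0"
    using f_add[of 0 0] g_add[of 0 0] by simp_all
  have sums: "\<Sum>S \<in> W N" "P (\<Sum>S) = 0" "\<Sum>(f ` S) = f (\<Sum>S)" "\<Sum>(g ` S) = g (\<Sum>S)"
    if "S \<subseteq> Bs" for S
  proof -
    have "finite S"
      using that fB finite_subset by blast
    then have "\<Sum>S \<in> W N \<and> P (\<Sum>S) = 0 \<and> \<Sum>(f ` S) = f (\<Sum>S) \<and> \<Sum>(g ` S) = g (\<Sum>S)"
      using that
    proof (induction S)
      case (insert b S)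
      then have b: "b \<in> W N" "P b = 0" and S: "S \<subseteq> W N"
        using cycle by auto
      have "f b \<notin> f ` S" "g b \<notin> g ` S"
        using inj insert.hyps b S unfolding inj_on_def by blast+
      then show ?case
        using insert b W_finite_supp[OF fin(1)] by (simp add: f_add g_add ops_add)
    qed (simp add: f0 g0)
    then show "\<Sum>S \<in> W N" "P (\<Sum>S) = 0" "\<Sum>(f ` S) = f (\<Sum>S)" "\<Sum>(g ` S) = g (\<Sum>S)"
      by auto
  qed
  have new_cycle: "c \<in> W N' \<and> P c = 0" if "c \<in> f ` Bs \<union> g ` Bs" for c
    using that
  proof
    assume "c \<in> f ` Bs"
    then obtain b where "b \<in> Bs" "c = f b"
      by blast
    then show ?thesis
      using cycle f_W f_P f0 by simp
  next
    assume "c \<in> g ` Bs"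
    then obtain b where "b \<in> Bs" "c = g b"
      by blast
    then show ?thesis
      using cycle g_W g_P g0 by simp
  qed
  have new_indep: "S = {}" if S: "S \<subseteq> f ` Bs \<union> g ` Bs" "\<Sum>S \<in> P ` W N'" for S
  proof -
    \<comment> \<open>The two images of \<open>Bs\<close> might meet; a common element is charged to
      f alone, which makes the two parts of \<open>S\<close> disjoint.\<close>
    define S1 where "S1 = {b \<in> Bs. f b \<in> S}"
    define S2 where "S2 = {b \<in> Bs. g b \<in> S \<and> g b \<notin> f ` Bs}"
    have sub: "S1 \<subseteq> Bs" "S2 \<subseteq> Bs"
      unfolding S1_def S2_def by blast+
    have S_eq: "S = f ` S1 \<union> g ` S2"
    proof (intro equalityI subsetI)
      fix c
      assume c: "c \<in> S"
      show "c \<in> f ` S1 \<union> g ` S2"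
      proof (cases "c \<in> f ` Bs")
        case True
        with c show ?thesis
          unfolding S1_def by blast
      next
        case False
        with c S(1) have "c \<in> g ` Bs"
          by blast
        with c False show ?thesis
          unfolding S2_def by blast
      qed
    next
      fix c
      assume "c \<in> f ` S1 \<union> g ` S2"
      then show "c \<in> S"
        unfolding S1_def S2_def by blast
    qed
    have "\<Sum>S = \<Sum>(f ` S1) + \<Sum>(g ` S2)"
      unfolding S_eq
    proof (rule sum.union_disjoint)
      show "finite (f ` S1)" "finite (g ` S2)"
        using fB sub finite_subset by blast+
      have "f ` S1 \<subseteq> f ` Bs"
        using sub by (intro image_mono)
      moreover have "c \<notin> f ` Bs" if "c \<in> g ` S2" for c
        using that by (rule imageE) (simp add: S2_def)
      ultimately show "f ` S1 \<inter> g ` S2 = {}"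
        by blast
    qed
    then have "f (\<Sum>S1) + g (\<Sum>S2) \<in> P ` W N'"
      using S(2) sub by (simp add: sums)
    then have "\<Sum>S1 \<in> P ` W N \<and> \<Sum>S2 \<in> P ` W N"
      using sub by (intro homology_inj sums)
    then have "S1 = {}" "S2 = {}"
      using indep sub by simp_all
    then show "S = {}"
      using S_eq by simp
  qed
  have new_span: "\<exists>S. S \<subseteq> f ` Bs \<union> g ` Bs \<and> z + \<Sum>S \<in> P ` W N'" if z: "z \<in> W N'" "P z = 0" for z
  proof -
    obtain s t u where st: "s \<in> W N" "t \<in> W N" "P s = 0" "P t = 0"
      and u: "u \<in> W N'" "z + (f s + g t) = P u"
      using homology_surj[OF z] by (elim bexE conjE imageE) simp
    obtain S1 p where S1: "S1 \<subseteq> Bs" and p: "p \<in> W N" "s + \<Sum>S1 = P p"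
      using span[OF st(1,3)] by (elim exE conjE imageE) simp
    obtain S2 q where S2: "S2 \<subseteq> Bs" and q: "q \<in> W N" "t + \<Sum>S2 = P q"
      using span[OF st(2,4)] by (elim exE conjE imageE) simp
    \<comment> \<open>A symmetric difference instead of a union: an element in both images would
      cancel in the sum.\<close>
    let ?S = "f ` S1 - g ` S2 \<union> (g ` S2 - f ` S1)"
    have "f s + f (\<Sum>S1) = P (f p)" "g t + g (\<Sum>S2) = P (g q)"
      using f_add[OF st(1) sums(1)[OF S1]] g_add[OF st(2) sums(1)[OF S2]] p q f_P g_P by simp_all
    then have fS: "f (\<Sum>S1) = P (f p) + f s" and gS: "g (\<Sum>S2) = P (g q) + g t"
      unfolding elem_add_eq_iff by (simp_all add: char2)
    have "finite (f ` S1)" "finite (g ` S2)"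
      using finite_subset[OF S1 fB] finite_subset[OF S2 fB] by simp_all
    then have "\<Sum>?S = f (\<Sum>S1) + g (\<Sum>S2)"
      using sums(3)[OF S1] sums(4)[OF S2] by (simp flip: sum_symdiff)
    then have "z + \<Sum>?S = (z + (f s + g t)) + (P (f p) + P (g q))"
      unfolding fS gS by (simp add: char2)
    also have "\<dots> = P (u + (f p + g q))"
      using u p q f_W g_W W_finite_supp[OF fin(2)] by (simp add: ops_add)
    finally have "z + \<Sum>?S \<in> P ` W N'"
      using u p q f_W g_W by simp
    moreover have "?S \<subseteq> f ` Bs \<union> g ` Bs"
      using S1 S2 by blast
    ultimately show ?thesis
      by blast
  qed
  show ?thesis
    unfolding margolis_basis_def
  proof (intro conjI allI ballI impI)
    show "finite (f ` Bs \<union> g ` Bs)"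
      using fB by simp
    show "c \<in> W N'" "P c = 0" if "c \<in> f ` Bs \<union> g ` Bs" for c
      using new_cycle[OF that] by simp_all
    show "S = {}" if "S \<subseteq> f ` Bs \<union> g ` Bs \<and> \<Sum>S \<in> P ` W N'" for S
      using that by (intro new_indep) simp_all
    show "\<exists>S. S \<subseteq> f ` Bs \<union> g ` Bs \<and> z + \<Sum>S \<in> P ` W N'" if "z \<in> W N'" "P z = 0" for z
      using that by (rule new_span)
  qed
qed

subsection \<open>Adjoining one or two indices to an even index set\<close>

text \<open>This and \<open>lower_ext\<close> are f and g of the overview, given by components so
  that uniqueness of the splitting applies. The lemmas \<open>raise_ext_eq\<close> and
  \<open>exch_raise_ext\<close> tie them to the recursion.\<close>

definition raise_ext :: "nat \<Rightarrow> elem \<Rightarrow> elem" where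
  "raise_ext a v = mulx (Q1 v) a + mult v a"

definition lower_ext :: "nat \<Rightarrow> elem \<Rightarrow> elem" where
  "lower_ext a v = mulx v a + mult (lower v) a"

context
  fixes N :: "nat set" and a :: nat
  assumes fin: "finite N" and a: "a \<notin> N" and ev: "even (card N)"
begin

private lemmas in_W [simp] = ops_in_W[OF fin]
private lemmas supp_W [simp] = W_finite_supp[OF fin]
private lemmas mul_W [simp] = mul_in_W[OF fin a]
text \<open>For even \<open>card N\<close> the relations act as rewrite rules that move
  \<open>lower\<close> outward and \<open>P\<close> inward, while all three squares vanish. Words in
  the operators thereby get a normal form.\<close>

private lemmas rels = commutation_relations[OF fin, simplified ev if_True add_0_right] lower_lower[OF fin]
private lemmas muls = Q1_mul[OF fin _ a] P_mul[OF fin _ a]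
private lemmas calc = ops_add lower_add muls rels char2

lemma ext_W [simp]:
  assumes "v \<in> W N"
  shows "raise_ext a v \<in> W (insert a N)" "lower_ext a v \<in> W (insert a N)"
  using assms by (simp_all add: raise_ext_def lower_ext_def)

lemma ext_add:
  assumes "u \<in> W N" "v \<in> W N"
  shows "raise_ext a (u + v) = raise_ext a u + raise_ext a v"
    "lower_ext a (u + v) = lower_ext a u + lower_ext a v"
  using assms by (simp_all add: raise_ext_def lower_ext_def ops_add lower_add char2)

text \<open>The extra coproduct term is \<open>Q1 (Q1 v)\<close>, hence 0, for
  \<open>raise_ext\<close>. For \<open>lower_ext\<close> it is \<open>Q1 v\<close>, which cancels
  the commutator of \<open>P\<close> and \<open>lower\<close>; this is where even parity
  enters.\<close>

lemma P_ext:
  assumes "v \<in> W N"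
  shows "P (raise_ext a v) = raise_ext a (P v)" "P (lower_ext a v) = lower_ext a (P v)"
  using assms by (simp_all add: raise_ext_def lower_ext_def calc)

lemma inj_ext: "inj_on (raise_ext a) (W N)" "inj_on (lower_ext a) (W N)"
  by (auto simp: inj_on_def raise_ext_def lower_ext_def mul_add_eq_iff[OF fin a])

lemma raise_ext_eq: "v \<in> W N \<Longrightarrow> Q1 (mulx v a) = raise_ext a v"
  by (simp add: raise_ext_def muls)

lemma exch_raise_ext: "v \<in> W N \<Longrightarrow> exch (raise_ext a v) = lower_ext a (exch v)"
  by (simp add: raise_ext_def lower_ext_def ops_add exch_mul exch_exch lower_def char2)

text \<open>\<open>1 + Q\<^sub>1 lower\<close> is an involution commuting with \<open>P\<close>.\<close>

lemma boundary_untwist: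
  assumes "s \<in> W N" "w \<in> W N" and Pw: "s + Q1 (lower s) = P w"
  shows "s \<in> P ` W N"
proof (rule image_eqI)
  \<comment> \<open>The witness is T w: applying T to both sides returns \<open>s\<close>, as T T =
    1 and T commutes with \<open>P\<close>.\<close>
  have "P (w + Q1 (lower w)) = P w + Q1 (lower (P w))"
    using assms(1,2) by (simp add: calc)
  also have "\<dots> = s"
    unfolding Pw[symmetric] using assms(1,2) by (simp add: calc)
  finally show "s = P (w + Q1 (lower w))" ..
qed (use assms(1,2) in simp)

text \<open>The combined map sends (s, t) to the components \<open>Q1 s + t\<close> and
  \<open>s + lower t\<close>. Eliminating t leaves T s, so everything rests on inverting T.\<close>

lemma margolis_basis_insert:
  assumes "margolis_basis N Bs"
  shows "margolis_basis (insert a N) (raise_ext a ` Bs \<union> lower_ext a ` Bs)"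
proof (rule margolis_basis_transfer[OF fin _ assms])
  fix s t
  assume st: "s \<in> W N" "t \<in> W N" "P s = 0" "P t = 0"
    and "raise_ext a s + lower_ext a t \<in> P ` W (insert a N)"
  then obtain u where u: "u \<in> W (insert a N)" "raise_ext a s + lower_ext a t = P u"
    by (elim imageE) simp
  obtain u0 u1 where u01: "u0 \<in> W N" "u1 \<in> W N" and u_eq: "u = mulx u0 a + mult u1 a"
    using W_insertE[OF fin a u(1)] .
  have "mulx (Q1 s + t) a + mult (s + lower t) a = mulx (P u0) a + mult (Q1 u0 + P u1) a"
    using u(2) st u01 by (simp add: u_eq raise_ext_def lower_ext_def calc)
  then have "Q1 s + t = P u0" and 2: "s + lower t = Q1 u0 + P u1"
    using st u01 by (simp_all add: mul_add_eq_iff[OF fin a])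
  \<comment> \<open>For a cycle \<open>s\<close> the commutator relation reads
    \<open>P (lower s) = Q1 s\<close>, so \<open>Q1 s\<close> is a boundary.\<close>
  then have t_eq: "t = P (u0 + lower s)"
    using st u01 by (simp add: calc flip: elem_add_eq_iff)
  have "s + Q1 (lower s) = P (u1 + lower (u0 + lower s))"
    using 2 st u01 unfolding elem_add_eq_iff t_eq by (simp add: calc)
  then have "s \<in> P ` W N"
    using st u01 by (intro boundary_untwist) simp_all
  moreover have "t \<in> P ` W N"
    by (rule image_eqI[where f = P, OF t_eq]) (use st u01 in simp)
  ultimately show "s \<in> P ` W N \<and> t \<in> P ` W N"
    by simp
next
  fix z
  assume z: "z \<in> W (insert a N)" "P z = 0"
  obtain z0 z1 where z01: "z0 \<in> W N" "z1 \<in> W N" and z_eq: "z = mulx z0 a + mult z1 a"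
    using W_insertE[OF fin a z(1)] .
  have "mulx (P z0) a + mult (Q1 z0 + P z1) a = mulx 0 a + mult 0 a"
    using z(2) z01 by (simp add: z_eq calc)
  then have Pz: "P z0 = 0" "P z1 = Q1 z0"
    using z01 by (simp_all add: mul_add_eq_iff[OF fin a] elem_add_eq_0_iff del: ops_0)
  define y where "y = z1 + lower z0"
  \<comment> \<open>The t_a component asks for T s = y up to boundaries; T is its own
    inverse.\<close>
  define s where "s = y + Q1 (lower y)"
  have y: "y \<in> W N" "P y = 0"
    using z01 Pz by (simp_all add: y_def calc)
  then have s: "s \<in> W N" "P s = 0" "lower s \<in> W N" "Q1 (lower s) = Q1 (lower y)"
    by (simp_all add: s_def calc)
  have "z + (raise_ext a s + lower_ext a z0) = mulx (Q1 s) a + mult (z1 + lower z0 + s) a"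
    using z01 s by (simp add: z_eq raise_ext_def lower_ext_def calc)
  also have "z1 + lower z0 + s = Q1 (lower s)"
    unfolding s(4) y_def[symmetric] unfolding s_def by (rule elem_add_self_left)
  \<comment> \<open>Again \<open>Q1 s = P (lower s)\<close>, so the remainder is the boundary of
    \<open>lower s\<close> times x_a.\<close>
  also have "mulx (Q1 s) a + mult (Q1 (lower s)) a = P (mulx (lower s) a)"
    using s(1-3) by (simp add: calc)
  finally have "z + (raise_ext a s + lower_ext a z0) \<in> P ` W (insert a N)"
    using s by simp
  then show "\<exists>s\<in>W N. \<exists>t\<in>W N. P s = 0 \<and> P t = 0 \<and>
      z + (raise_ext a s + lower_ext a t) \<in> P ` W (insert a N)"
    using s z01 Pz by (intro bexI[of _ s] bexI[of _ z0] conjI)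
qed (simp_all add: fin ext_add P_ext inj_ext)

text \<open>Since P sends x_a x_b to t_a t_b, two of the four copies of \<open>W N\<close> cancel in
  homology, and two copies of the homology of \<open>W N\<close> remain.\<close>

lemma margolis_basis_insert2:
  assumes b: "b \<notin> insert a N" and basis: "margolis_basis N Bs"
  shows "margolis_basis (insert b (insert a N))
    ((\<lambda>v. mulx (raise_ext a v) b) ` Bs \<union> (\<lambda>v. mult (lower_ext a v) b) ` Bs)"
proof (rule margolis_basis_transfer[OF fin _ basis])
  let ?M = "insert a N"
  have fin': "finite ?M"
    using fin by simp
  note supp_M = W_finite_supp[OF fin']
  note mul_M = mul_in_W[OF fin' b]
  note muls_M = Q1_mul[OF fin' _ b] P_mul[OF fin' _ b]
  note iff_N = mul_add_eq_iff[OF fin a] and iff_M = mul_add_eq_iff[OF fin' b]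
  show "mulx (raise_ext a (u + v)) b = mulx (raise_ext a u) b + mulx (raise_ext a v) b"
    "mult (lower_ext a (u + v)) b = mult (lower_ext a u) b + mult (lower_ext a v) b"
    if "u \<in> W N" "v \<in> W N" for u v
    using that by (simp_all add: ext_add ops_add supp_M)
  show "mulx (raise_ext a v) b \<in> W (insert b ?M)" "mult (lower_ext a v) b \<in> W (insert b ?M)"
    if "v \<in> W N" for v
    using that by (simp_all add: mul_M)
  \<comment> \<open>This kills the Q_1 \<otimes> Q_1 term, so multiplying
    \<open>raise_ext a v\<close> by x_b is compatible with \<open>P\<close>.\<close>
  have Q_ext: "Q1 (raise_ext a v) = 0" if "v \<in> W N" for v
    using that by (simp add: raise_ext_def calc)
  show "P (mulx (raise_ext a v) b) = mulx (raise_ext a (P v)) b"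
    "P (mult (lower_ext a v) b) = mult (lower_ext a (P v)) b" if "v \<in> W N" for v
    using that by (simp_all add: muls_M P_ext Q_ext)
  show "inj_on (\<lambda>v. mulx (raise_ext a v) b) (W N)"
  proof (rule inj_onI)
    fix u v
    assume uv: "u \<in> W N" "v \<in> W N" "mulx (raise_ext a u) b = mulx (raise_ext a v) b"
    then have "raise_ext a u = raise_ext a v"
      using iff_M[of "raise_ext a u" 0 "raise_ext a v" 0] by simp
    with uv show "u = v"
      using inj_onD[OF inj_ext(1)] by simp
  qed
  show "inj_on (\<lambda>v. mult (lower_ext a v) b) (W N)"
  proof (rule inj_onI)
    fix u v
    assume uv: "u \<in> W N" "v \<in> W N" "mult (lower_ext a u) b = mult (lower_ext a v) b"
    then have "lower_ext a u = lower_ext a v"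
      using iff_M[of 0 "lower_ext a u" 0 "lower_ext a v"] by simp
    with uv show "u = v"
      using inj_onD[OF inj_ext(2)] by simp
  qed
  \<comment> \<open>The coordinates belong to x_a x_b, t_a x_b, x_a t_b, t_a t_b in this order. The
    bare \<open>u0\<close> in the last one comes from P(x_a x_b) = t_a t_b.\<close>
  have P_quad: "P (mulx (mulx u0 a + mult u1 a) b + mult (mulx u2 a + mult u3 a) b) =
      mulx (mulx (P u0) a + mult (Q1 u0 + P u1) a) b
      + mult (mulx (Q1 u0 + P u2) a + mult (u0 + Q1 u1 + Q1 u2 + P u3) a) b"
    if "u0 \<in> W N" "u1 \<in> W N" "u2 \<in> W N" "u3 \<in> W N" for u0 u1 u2 u3
    using that by (simp add: ops_add muls_M) (simp add: calc)
  have quad_iff: "mulx (mulx u0 a + mult u1 a) b + mult (mulx u2 a + mult u3 a) b =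
      mulx (mulx v0 a + mult v1 a) b + mult (mulx v2 a + mult v3 a) b \<longleftrightarrow>
      u0 = v0 \<and> u1 = v1 \<and> u2 = v2 \<and> u3 = v3"
    if "u0 \<in> W N" "u1 \<in> W N" "u2 \<in> W N" "u3 \<in> W N" "v0 \<in> W N" "v1 \<in> W N" "v2 \<in> W N" "v3 \<in> W N"
    for u0 u1 u2 u3 v0 v1 v2 v3
    using that by (simp add: iff_M iff_N)
  have quadE: "\<exists>u0\<in>W N. \<exists>u1\<in>W N. \<exists>u2\<in>W N. \<exists>u3\<in>W N.
      u = mulx (mulx u0 a + mult u1 a) b + mult (mulx u2 a + mult u3 a) b"
    if u: "u \<in> W (insert b ?M)" for u
  proof -
    obtain p q where pq: "p \<in> W ?M" "q \<in> W ?M" "u = mulx p b + mult q b"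
      using W_insertE[OF fin' b u] .
    obtain u0 u1 where "u0 \<in> W N" "u1 \<in> W N" "p = mulx u0 a + mult u1 a"
      using W_insertE[OF fin a pq(1)] .
    moreover obtain u2 u3 where "u2 \<in> W N" "u3 \<in> W N" "q = mulx u2 a + mult u3 a"
      using W_insertE[OF fin a pq(2)] .
    ultimately show ?thesis
      using pq(3) by metis
  qed
  {
    fix s t
    assume st: "s \<in> W N" "t \<in> W N" "P s = 0" "P t = 0"
      and "mulx (raise_ext a s) b + mult (lower_ext a t) b \<in> P ` W (insert b ?M)"
    then obtain u where u: "u \<in> W (insert b ?M)"
      "mulx (raise_ext a s) b + mult (lower_ext a t) b = P u"
      by (elim imageE) simp
    obtain u0 u1 u2 u3 where uW: "u0 \<in> W N" "u1 \<in> W N" "u2 \<in> W N" "u3 \<in> W N"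
      and u_eq: "u = mulx (mulx u0 a + mult u1 a) b + mult (mulx u2 a + mult u3 a) b"
      using quadE[OF u(1)] by (elim bexE)
    note eq = u(2)[unfolded u_eq raise_ext_def lower_ext_def P_quad[OF uW]]
    have coords: "Q1 s = P u0 \<and> s = Q1 u0 + P u1 \<and> t = Q1 u0 + P u2
        \<and> lower t = u0 + Q1 u1 + Q1 u2 + P u3"
      by (rule iffD1[OF quad_iff eq]) (use uW st in simp_all)
    note s = coords[THEN conjunct2, THEN conjunct1]
      and t = coords[THEN conjunct2, THEN conjunct2, THEN conjunct1]
      and lower_t = coords[THEN conjunct2, THEN conjunct2, THEN conjunct2]
    \<comment> \<open>The last coordinate holds \<open>u0\<close> with no operator applied, so it
      eliminates \<open>u0\<close>; the third then says that T t is a boundary.\<close>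
    have u0: "u0 = lower t + Q1 u1 + Q1 u2 + P u3"
      unfolding lower_t by (simp add: char2)
    have Qu0: "Q1 u0 = Q1 (lower t) + P (Q1 u3)"
      using uW st by (subst u0) (simp add: calc)
    have "t + Q1 (lower t) = P (Q1 u3 + u2)"
      using uW st by (subst t) (simp add: Qu0 ops_add char2)
    then have "t \<in> P ` W N"
      using st uW by (intro boundary_untwist) simp_all
    then obtain r where r: "r \<in> W N" "t = P r"
      by (elim imageE) simp
    \<comment> \<open>With \<open>t = P r\<close>, the term \<open>Q1 (lower t)\<close> equals
      \<open>P (Q1 (lower r))\<close>.\<close>
    have "s = P (Q1 u3 + u1 + Q1 (lower r))"
      using uW r by (simp add: s Qu0 r(2) calc)
    then have "s \<in> P ` W N"
      by (rule image_eqI[where f = P]) (use uW r in simp)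
    with \<open>t \<in> P ` W N\<close> show "s \<in> P ` W N \<and> t \<in> P ` W N"
      by simp
  }
  {
    fix z
    assume z: "z \<in> W (insert b ?M)" "P z = 0"
    obtain z0 z1 z2 z3 where zW: "z0 \<in> W N" "z1 \<in> W N" "z2 \<in> W N" "z3 \<in> W N"
      and z_eq: "z = mulx (mulx z0 a + mult z1 a) b + mult (mulx z2 a + mult z3 a) b"
      using quadE[OF z(1)] by (elim bexE)
    have "P z0 = 0 \<and> Q1 z0 + P z1 = 0 \<and> Q1 z0 + P z2 = 0 \<and> z0 + Q1 z1 + Q1 z2 + P z3 = 0"
      using z(2) zW quad_iff[of "P z0" "Q1 z0 + P z1" "Q1 z0 + P z2" "z0 + Q1 z1 + Q1 z2 + P z3"
          0 0 0 0]
      unfolding z_eq P_quad[OF zW] by simp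
    then have Pz: "P z0 = 0" "P z1 = Q1 z0" "P z2 = Q1 z0" "P z3 = z0 + Q1 z1 + Q1 z2"
      unfolding elem_add_eq_0_iff by metis+
    \<comment> \<open>Adding the boundary of \<open>?v\<close> times x_a x_b, with
      \<open>?v = z3 + lower t\<close>, turns the last coordinate into \<open>lower t\<close>. The
      third coordinate then requires T t = y, hence t = T y, and the second one yields
      \<open>s\<close>.\<close>
    define y where "y = z2 + Q1 z3"
    define t where "t = y + Q1 (lower y)"
    define s where "s = z1 + Q1 z3 + Q1 (lower y)"
    have y: "y \<in> W N" "P y = 0"
      using zW Pz by (simp_all add: y_def calc)
    have t: "t \<in> W N" "P t = 0" "Q1 t = Q1 y" "Q1 (lower t) = Q1 (lower y)"
      using y by (simp_all add: t_def calc)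
    have s: "s \<in> W N" "P s = 0" "Q1 s = Q1 z1"
      using y zW Pz by (simp_all add: s_def calc)
    let ?v = "z3 + lower t"
    have v: "?v \<in> W N" "Q1 ?v = Q1 z3 + Q1 (lower y)" "P ?v = z0 + Q1 z1"
      using t y zW Pz by (simp_all add: calc) (simp_all add: y_def calc)
    have "z + (mulx (raise_ext a s) b + mult (lower_ext a t) b) =
        mulx (mulx (z0 + Q1 s) a + mult (z1 + s) a) b
        + mult (mulx (z2 + t) a + mult (z3 + lower t) a) b"
      using zW s t by (simp add: z_eq raise_ext_def lower_ext_def ops_add char2)
    also have "\<dots> = P (mulx (mulx ?v a + mult 0 a) b + mult (mulx 0 a + mult 0 a) b)"
      using v zW y unfolding P_quad[OF v(1) W_0 W_0 W_0]
      by (simp add: s(3)) (simp add: s_def t_def y_def char2)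
    finally have "z + (mulx (raise_ext a s) b + mult (lower_ext a t) b) \<in> P ` W (insert b ?M)"
      by (rule image_eqI[where f = P]) (use v mul_M in simp)
    then show "\<exists>s\<in>W N. \<exists>t\<in>W N. P s = 0 \<and> P t = 0 \<and>
        z + (mulx (raise_ext a s) b + mult (lower_ext a t) b) \<in> P ` W (insert b ?M)"
      using s t by (intro bexI[of _ s] bexI[of _ t] conjI)
  }
qed (simp add: fin)

end

section \<open>Induction along the recursion for the basis sets\<close>

lemma Beven_basis:
  "margolis_basis {1..2*t} (Beven t) \<and> exch ` Beven t = Beven t"
proof (induction t)
  case 0
  have mono: "mono {} {} \<in> W {}"
    using mono_in_W[of "{}" "{}"] by simp
  \<comment> \<open>\<open>W {}\<close> consists of 0 and 1 and \<open>P\<close> vanishes on it, so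
    it is its own homology, with basis 1.\<close>
  have W_empty: "v = 0 \<or> v = mono {} {}" if "v \<in> W {}" for v
  proof (cases "v ({}, {})")
    case zero
    have "v m = 0" for m
      using W_eq_0[OF that, of m] zero by (cases "m = ({}, {})") auto
    then have "v = 0"
      by (intro ext) (simp add: pointwise)
    then show ?thesis ..
  next
    case one
    have "v m = mono {} {} m" for m
      using W_eq_0[OF that, of m] one by (cases "m = ({}, {})") (auto simp: mono_def)
    then show ?thesis
      by blast
  qed
  have "P ` W {} = (\<lambda>_. 0) ` W {}"
    by (rule image_cong) (simp_all add: ops_W_empty)
  then have PW: "P ` W {} = {0}"
    using image_constant[OF mono] by simp
  have ne: "mono {} {} \<noteq> 0"
    by (metis mono_def zero_fun_apply zero_neq_one)
  have "margolis_basis {} {mono {} {}}"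
    unfolding margolis_basis_def PW
  proof (intro conjI allI ballI impI)
    fix b
    assume "b \<in> {mono {} {}}"
    then show "b \<in> W {}" "P b = 0"
      using mono ops_W_empty by simp_all
  next
    fix S :: "elem set"
    assume S: "S \<subseteq> {mono {} {}} \<and> \<Sum>S \<in> {0}"
    then have "S = {} \<or> S = {mono {} {}}"
      by (simp add: subset_singleton_iff)
    moreover have "S \<noteq> {mono {} {}}"
    proof
      assume "S = {mono {} {}}"
      then have "\<Sum>S = mono {} {}"
        by simp
      with S ne show False
        by simp
    qed
    ultimately show "S = {}"
      by argo
  next
    fix z
    assume "z \<in> W {}"
    from W_empty[OF this] show "\<exists>S. S \<subseteq> {mono {} {}} \<and> z + \<Sum>S \<in> {0}"
    proof
      assume "z = 0"
      then show ?thesis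
        by (intro exI[of _ "{}"]) simp
    next
      assume "z = mono {} {}"
      then show ?thesis
        by (intro exI[of _ "{mono {} {}}"]) (simp add: elem_add_self)
    qed
  qed simp
  then show ?case
    by (simp add: ops_mono)
next
  case (Suc t)
  let ?N = "{1..2*t}" and ?a = "2*t+1" and ?b = "2*t+2"
  have N: "finite ?N" "?a \<notin> ?N" "even (card ?N)" "?b \<notin> insert ?a ?N"
    by simp_all
  have basis: "margolis_basis ?N (Beven t)" and exch: "exch ` Beven t = Beven t"
    using Suc.IH by simp_all
  have W: "v \<in> W ?N" if "v \<in> Beven t" for v
    using basis that unfolding margolis_basis_def by blast
  have raise: "(\<lambda>v. mulx (Q1 (mulx v ?a)) ?b) ` Beven t = (\<lambda>v. mulx (raise_ext ?a v) ?b) ` Beven t"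
    by (rule image_cong[OF refl]) (simp only: raise_ext_eq[OF N(1,2,3)] W)
  \<comment> \<open>Exchanging Q_1(b x_a) gives \<open>lower_ext\<close> of \<open>exch b\<close>,
    not of b; closure of \<open>Beven t\<close> under exchange lets the range be reindexed.\<close>
  have "(\<lambda>v. mult (exch (Q1 (mulx v ?a))) ?b) ` Beven t
      = (\<lambda>v. mult (lower_ext ?a v) ?b) ` exch ` Beven t"
    unfolding image_image
    by (rule image_cong[OF refl])
      (simp only: raise_ext_eq[OF N(1,2,3)] exch_raise_ext[OF N(1,2,3)] W)
  then have lower: "(\<lambda>v. mult (exch (Q1 (mulx v ?a))) ?b) ` Beven t
      = (\<lambda>v. mult (lower_ext ?a v) ?b) ` Beven t"
    unfolding exch .
  have "{1..2 * Suc t} = insert ?b (insert ?a ?N)"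
    by auto
  then have "margolis_basis {1..2 * Suc t} (Beven (Suc t))"
    using margolis_basis_insert2[OF N basis] unfolding Beven.simps raise lower by simp
  \<comment> \<open>Exchange swaps x_b with t_b, so it interchanges the two families of the
    recursion.\<close>
  moreover have "exch ` Beven (Suc t) = Beven (Suc t)"
    unfolding Beven.simps image_Un image_image
    by (simp add: exch_mul exch_exch Un_commute)
  ultimately show ?case ..
qed

lemma B_basis: "margolis_basis {1..n} (B n)"
proof (cases "even n")
  case True
  then obtain t where "n = 2 * t"
    by (elim evenE)
  then show ?thesis
    using Beven_basis[of t] by (simp add: B_def)
next
  case False
  then obtain t where n: "n = 2 * t + 1"
    by (elim oddE)
  let ?N = "{1..2*t}"
  have N: "finite ?N" "n \<notin> ?N" "even (card ?N)"
    by (simp_all add: n)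
  have basis: "margolis_basis ?N (Beven t)" and exch: "exch ` Beven t = Beven t"
    using Beven_basis by simp_all
  have W: "v \<in> W ?N" if "v \<in> Beven t" for v
    using basis that unfolding margolis_basis_def by blast
  have raise: "(\<lambda>v. Q1 (mulx v n)) ` Beven t = raise_ext n ` Beven t"
    by (rule image_cong[OF refl]) (simp only: raise_ext_eq[OF N] W)
  have "(\<lambda>v. exch (Q1 (mulx v n))) ` Beven t = lower_ext n ` exch ` Beven t"
    unfolding image_image
    by (rule image_cong[OF refl]) (simp only: raise_ext_eq[OF N] exch_raise_ext[OF N] W)
  then have lower: "(\<lambda>v. exch (Q1 (mulx v n))) ` Beven t = lower_ext n ` Beven t"
    unfolding exch .
  have "n div 2 = t"
    by (simp add: n)
  then have "B n = raise_ext n ` Beven t \<union> lower_ext n ` Beven t"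
    using False \<open>n div 2 = t\<close> by (simp add: B_def raise lower)
  moreover have "{1..n} = insert n ?N"
    by (auto simp: n)
  ultimately show ?thesis
    using margolis_basis_insert[OF N basis] by simp
qed

theorem mainTheorem11:
  fixes n :: nat
  shows "(\<forall>b\<in>B n. b \<in> W {1..n} \<and> P b = zeroE)
    \<and> (\<forall>S. S \<subseteq> B n \<and> sumE S \<in> P ` W {1..n} \<longrightarrow> S = {})
    \<and> (\<forall>z\<in>W {1..n}. P z = zeroE \<longrightarrow>
          (\<exists>S. S \<subseteq> B n \<and> addE z (sumE S) \<in> P ` W {1..n}))"
  using B_basis[of n] unfolding margolis_basis_def zeroE_eq addE_eq sumE_eq by (elim conjE) (intro conjI)

end
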